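(* Let $M=(E,r)$ be an arbitrary matroid on a finite ground set $E$ with rank function $r$, let $M^*=(E,r^* )$ be its dual matroid, and let $q\in\mathbb{C}\setminus\{0,1\}$. Then $$\chi_{M^*}(q)\,\zeta_q(-1)^{|E|}=\sum_{A\subseteq E}(-1)^{|E|-|A|}\,\frac{\chi_{M|A}(q)}{q^{r(A)}}\,\zeta_q(1)^{|A|}$$ and $$\frac{\chi_{M^*}(q)}{q^{r^*(E)}}\,\zeta_q(1)^{|E|}=\sum_{A\subseteq E}\zeta_q(-1)^{|E|-|A|}\,\chi_{M/A}(q).$$
   Context: A matroid $M=(E,r)$ is a finite set $E$ with a rank function $r:2^E\to\mathbb{N}_0$ satisfying: $0\le r(A)\le|A|$; $r(A)\le r(B)$ for $A\subseteq B$; $r(A\cup B)+r(A\cap B)\le r(A)+r(B)$. The dual matroid $M^*=(E,r^* )$ has rank function $r^*(A)=r(E-A)+|A|-r(E)$. For $A\subseteq E$, the restriction $M|A$ is the matroid on $A$ whose rank function is $r$ restricted to $2^A$; the contraction $M/A$ is the matroid on $E-A$ with rank function $B\mapsto r(A\cup B)-r(A)$. The characteristic polynomial of $M$ is $$\chi_M(x)=\sum_{A\subseteq E}(-1)^{|A|}x^{r(E)-r(A)}.$$ For $q\notin\{0,1\}$ put $\zeta_q(z)=\frac{1}{1-q^{-z}}$, so that $\zeta_q(1)=\frac{1}{1-q^{-1}}=\frac{q}{q-1}$ and $\zeta_q(-1)=\frac{1}{1-q}$. *)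

theory Defs
  imports
    "HOL-Analysis.Complex_Transcendental"
    "HOL-Computational_Algebra.Polynomial"
begin

text \<open>
  A matroid is given by its ground set and its rank function. The rank function is total on the
  type, but only its values on subsets of the ground set are constrained or used.
\<close>

record 'a ranked_set =
  ground :: "'a set"
  rk :: "'a set \<Rightarrow> nat"

locale matroid =
  fixes M :: "'a ranked_set"
  assumes finite_ground: "finite (ground M)"
    and rk_le_card: "A \<subseteq> ground M \<Longrightarrow> rk M A \<le> card A"
    and rk_mono: "A \<subseteq> B \<Longrightarrow> B \<subseteq> ground M \<Longrightarrow> rk M A \<le> rk M B"
    and rk_submodular: "A \<subseteq> ground M \<Longrightarrow> B \<subseteq> ground M \<Longrightarrow>
      rk M (A \<union> B) + rk M (A \<inter> B) \<le> rk M A + rk M B"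

text \<open>
  The subtractions of natural numbers below never truncate when \<open>M\<close> is a matroid and all sets
  are subsets of the ground set; see \<open>rk_ground_le\<close> for the one in the dual, and \<open>rk_mono\<close> for
  the others.
\<close>

definition dual :: "'a ranked_set \<Rightarrow> 'a ranked_set" where
  "dual M = \<lparr>ground = ground M,
     rk = (\<lambda>A. rk M (ground M - A) + card A - rk M (ground M))\<rparr>"

definition restriction :: "'a ranked_set \<Rightarrow> 'a set \<Rightarrow> 'a ranked_set" where
  "restriction M A = \<lparr>ground = A, rk = rk M\<rparr>"

definition contraction :: "'a ranked_set \<Rightarrow> 'a set \<Rightarrow> 'a ranked_set" where
  "contraction M A = \<lparr>ground = ground M - A, rk = (\<lambda>B. rk M (A \<union> B) - rk M A)\<rparr>"

definition characteristic_poly :: "'a ranked_set \<Rightarrow> complex poly" where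
  "characteristic_poly M =
     (\<Sum>A \<in> Pow (ground M). monom ((-1) ^ card A) (rk M (ground M) - rk M A))"

text \<open>
  For non-integral \<open>z\<close> this uses the principal branch of the complex power; for integral \<open>z\<close>
  and \<open>q \<noteq> 0\<close> the value does not depend on the branch.
\<close>

definition zeta :: "complex \<Rightarrow> complex \<Rightarrow> complex" where
  "zeta q z = 1 / (1 - q powr (- z))"

lemma zeta_1: "q \<noteq> 0 \<Longrightarrow> q \<noteq> 1 \<Longrightarrow> zeta q 1 = q / (q - 1)"
  by (simp add: zeta_def powr_minus field_simps)

lemma zeta_minus_1: "q \<noteq> 0 \<Longrightarrow> zeta q (-1) = 1 / (1 - q)"
  by (simp add: zeta_def)

lemma poly_characteristic_poly:
  "poly (characteristic_poly M) x =
     (\<Sum>A \<in> Pow (ground M). (-1) ^ card A * x ^ (rk M (ground M) - rk M A))"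
  by (simp add: characteristic_poly_def poly_sum poly_monom)

context matroid
begin

lemma rk_ground_le:
  assumes "A \<subseteq> ground M"
  shows "rk M (ground M) \<le> rk M (ground M - A) + card A"
proof -
  have "rk M ((ground M - A) \<union> A) + rk M ((ground M - A) \<inter> A) \<le> rk M (ground M - A) + rk M A"
    using assms by (intro rk_submodular) auto
  moreover have "(ground M - A) \<union> A = ground M"
    using assms by auto
  ultimately show ?thesis
    using rk_le_card[OF assms] by simp
qed

lemma matroid_restriction:
  assumes "A \<subseteq> ground M"
  shows "matroid (restriction M A)"
proof
  show "finite (ground (restriction M A))"
    using assms finite_ground finite_subset by (auto simp: restriction_def)
qed (use assms in \<open>auto simp: restriction_def intro: rk_le_card rk_mono rk_submodular\<close>)

lemma matroid_contraction:
  assumes A: "A \<subseteq> ground M"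
  shows "matroid (contraction M A)"
proof
  show "finite (ground (contraction M A))"
    using finite_ground by (simp add: contraction_def)
next
  fix B assume "B \<subseteq> ground (contraction M A)"
  then have B: "B \<subseteq> ground M" by (auto simp: contraction_def)
  show "rk (contraction M A) B \<le> card B"
    using rk_submodular[OF A B] rk_le_card[OF B] by (simp add: contraction_def)
next
  fix B C assume "B \<subseteq> C" "C \<subseteq> ground (contraction M A)"
  then have "rk M (A \<union> B) \<le> rk M (A \<union> C)"
    using A by (intro rk_mono) (auto simp: contraction_def)
  then show "rk (contraction M A) B \<le> rk (contraction M A) C"
    by (simp add: contraction_def)
next
  fix B C assume "B \<subseteq> ground (contraction M A)" "C \<subseteq> ground (contraction M A)"
  then have BC: "A \<union> B \<subseteq> ground M" "A \<union> C \<subseteq> ground M"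
    using A by (auto simp: contraction_def)
  have eq: "(A \<union> B) \<union> (A \<union> C) = A \<union> (B \<union> C)" "(A \<union> B) \<inter> (A \<union> C) = A \<union> (B \<inter> C)"
    by auto
  have ge: "rk M A \<le> rk M (A \<union> B)" "rk M A \<le> rk M (A \<union> C)"
    "rk M A \<le> rk M (A \<union> (B \<union> C))" "rk M A \<le> rk M (A \<union> (B \<inter> C))"
    using BC by (auto intro!: rk_mono)
  show "rk (contraction M A) (B \<union> C) + rk (contraction M A) (B \<inter> C)
      \<le> rk (contraction M A) B + rk (contraction M A) C"
    using rk_submodular[OF BC] ge by (simp add: contraction_def eq)
qed

lemma matroid_dual: "matroid (dual M)"
proof
  show "finite (ground (dual M))"
    using finite_ground by (simp add: dual_def)
next
  fix A assume "A \<subseteq> ground (dual M)"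
  have "rk M (ground M - A) \<le> rk M (ground M)"
    by (intro rk_mono) auto
  then show "rk (dual M) A \<le> card A"
    by (simp add: dual_def)
next
  fix A B assume "A \<subseteq> B" "B \<subseteq> ground (dual M)"
  then have AB: "A \<subseteq> B" "B \<subseteq> ground M" by (auto simp: dual_def)
  then have fin: "finite A" "finite B"
    using finite_ground by (meson finite_subset)+
  have "rk M ((ground M - B) \<union> (B - A)) + rk M ((ground M - B) \<inter> (B - A))
      \<le> rk M (ground M - B) + rk M (B - A)"
    using AB by (intro rk_submodular) auto
  moreover have "(ground M - B) \<union> (B - A) = ground M - A"
    using AB by auto
  moreover have "rk M (B - A) \<le> card B - card A"
    using rk_le_card[of "B - A"] AB fin by (auto simp: card_Diff_subset)
  moreover have "card A \<le> card B"
    using AB fin by (simp add: card_mono)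
  ultimately show "rk (dual M) A \<le> rk (dual M) B"
    by (simp add: dual_def)
next
  fix A B assume "A \<subseteq> ground (dual M)" "B \<subseteq> ground (dual M)"
  then have AB: "A \<subseteq> ground M" "B \<subseteq> ground M" by (auto simp: dual_def)
  then have fin: "finite A" "finite B"
    using finite_ground by (meson finite_subset)+
  have "rk M ((ground M - A) \<union> (ground M - B)) + rk M ((ground M - A) \<inter> (ground M - B))
      \<le> rk M (ground M - A) + rk M (ground M - B)"
    by (intro rk_submodular) auto
  moreover have "(ground M - A) \<union> (ground M - B) = ground M - (A \<inter> B)"
    "(ground M - A) \<inter> (ground M - B) = ground M - (A \<union> B)"
    by auto
  moreover have "card A + card B = card (A \<union> B) + card (A \<inter> B)"
    using fin by (rule card_Un_Int)
  moreover have "rk M (ground M) \<le> rk M (ground M - C) + card C"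
    if "C \<in> {A, B, A \<union> B, A \<inter> B}" for C
    using that AB by (intro rk_ground_le) auto
  ultimately show "rk (dual M) (A \<union> B) + rk (dual M) (A \<inter> B) \<le> rk (dual M) A + rk (dual M) B"
    by (fastforce simp: dual_def)
qed

end

end

theory Submission
  imports Defs
begin

text \<open>
  Expanding the characteristic polynomials on the right-hand sides gives sums over nested pairs of
  sets. Once the set carrying the rank exponent is moved outside, the inner sums are binomial, and
  they collapse because \<open>\<zeta>\<^sub>q(1) + \<zeta>\<^sub>q(-1) = 1\<close>. Up to a constant factor, what remains is
  the sum over \<open>B\<close> of \<open>(-1)\<^bsup>|E|-|B|\<^esup> q\<^bsup>|B|-r(B)\<^esup>\<close>, which is the characteristic polynomial of the
  dual after substituting \<open>B\<close> for its complement.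
\<close>

text \<open>A nested pair \<open>B\<close> inside \<open>A\<close> is the same data as the disjoint
  pair of \<open>B\<close> and \<open>C = A - B\<close>. The restriction identity uses this left to
  right, the contraction identity right to left.\<close>

lemma sum_nested_subsets:
  assumes "finite E"
  shows "(\<Sum>A\<in>Pow E. \<Sum>B\<in>Pow A. f A B) = (\<Sum>B\<in>Pow E. \<Sum>C\<in>Pow (E - B). f (B \<union> C) B)"
proof -
  have fin: "finite A" if "A \<in> Pow E" for A
    using that assms finite_subset by auto
  have "(\<Sum>A\<in>Pow E. \<Sum>B\<in>Pow A. f A B) = (\<Sum>(A, B)\<in>(SIGMA A:Pow E. Pow A). f A B)"
    by (rule sum.Sigma) (use assms fin in auto)
  also have "\<dots> = (\<Sum>(B, C)\<in>(SIGMA B:Pow E. Pow (E - B)). f (B \<union> C) B)"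
    by (rule sum.reindex_bij_witness[where
          i = "\<lambda>(B, C). (B \<union> C, B)" and j = "\<lambda>(A, B). (B, A - B)"])
      (auto simp: Un_absorb1)
  also have "\<dots> = (\<Sum>B\<in>Pow E. \<Sum>C\<in>Pow (E - B). f (B \<union> C) B)"
    by (rule sum.Sigma[symmetric]) (use assms in auto)
  finally show ?thesis .
qed

text \<open>Expanding the product of \<open>x + y\<close> over \<open>S\<close> means choosing a
  summand at each element; \<open>B\<close> records where \<open>x\<close> is chosen.\<close>

lemma binomial_subsets:
  fixes x y :: "'b::comm_semiring_1"
  assumes "finite S"
  shows "(\<Sum>B\<in>Pow S. x ^ card B * y ^ (card S - card B)) = (x + y) ^ card S"
proof -
  have "(x + y) ^ card S = (\<Prod>i\<in>S. x + y)"
    by simp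
  also have "\<dots> = (\<Sum>B\<in>Pow S. (\<Prod>i\<in>B. x) * (\<Prod>i\<in>S - B. y))"
    using assms by (rule prod_add)
  also have "\<dots> = (\<Sum>B\<in>Pow S. x ^ card B * y ^ (card S - card B))"
    using assms by (intro sum.cong) (auto simp: card_Diff_subset finite_subset)
  finally show ?thesis by simp
qed

text \<open>Trading one zeta value for the other is what creates the powers of \<open>q\<close> that
  the dual polynomial requires.\<close>

lemma zeta_1_eq:
  assumes "q \<noteq> 0" "q \<noteq> 1"
  shows "zeta q 1 = - (q * zeta q (-1))"
  using assms by (simp add: zeta_1 zeta_minus_1 field_simps)

lemma zeta_add_minus_1:
  assumes "q \<noteq> 0" "q \<noteq> 1"
  shows "zeta q 1 + zeta q (-1) = 1"
  unfolding zeta_1_eq[OF assms] using assms by (simp add: zeta_minus_1 field_simps)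

context matroid
begin

lemma rk_empty: "rk M {} = 0"
  using rk_le_card[of "{}"] by simp

lemma rk_dual_ground: "rk (dual M) (ground M) = card (ground M) - rk M (ground M)"
  by (simp add: dual_def rk_empty)

lemma card_le_ground: "A \<subseteq> ground M \<Longrightarrow> card A \<le> card (ground M)"
  by (simp add: card_mono finite_ground)

text \<open>Passing to complements cancels the rank of the ground set from the exponent, leaving the
  nullity \<open>card B - rk M B\<close>. Both identities are reduced to this sum.\<close>

lemma characteristic_poly_dual:
  assumes "q \<noteq> 0"
  shows "poly (characteristic_poly (dual M)) q =
    (\<Sum>B\<in>Pow (ground M). (-1) ^ (card (ground M) - card B) * (q ^ card B / q ^ rk M B))"
proof -
  let ?E = "ground M"
  have exponent: "rk (dual M) ?E - rk (dual M) (?E - B) = card B - rk M B" if "B \<subseteq> ?E" for B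
  proof -
    have "card (?E - B) = card ?E - card B"
      using that finite_ground by (simp add: card_Diff_subset finite_subset)
    moreover have "?E - (?E - B) = B"
      using that by blast
    ultimately show ?thesis
      \<comment> \<open>The two instances of \<open>rk_ground_le\<close> keep the subtractions in
        the dual ranks of \<open>?E - B\<close> and of \<open>?E\<close> from truncating.\<close>
      using rk_ground_le[of "?E - B"] rk_ground_le[of ?E] rk_le_card[OF that] card_le_ground[OF that]
      by (simp add: dual_def rk_empty)
  qed
  have "poly (characteristic_poly (dual M)) q =
      (\<Sum>A\<in>Pow ?E. (-1) ^ card A * q ^ (rk (dual M) ?E - rk (dual M) A))"
    by (simp add: poly_characteristic_poly dual_def)
  also have "\<dots> = (\<Sum>B\<in>Pow ?E. (-1) ^ card (?E - B) *
      q ^ (rk (dual M) ?E - rk (dual M) (?E - B)))"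
    by (rule sum.reindex_bij_witness[where i = "\<lambda>B. ?E - B" and j = "\<lambda>A. ?E - A"])
      (auto simp: double_diff)
  also have "\<dots> = (\<Sum>B\<in>Pow ?E. (-1) ^ (card ?E - card B) * (q ^ card B / q ^ rk M B))"
    using assms finite_ground
    by (intro sum.cong)
      (auto simp: exponent power_diff rk_le_card card_Diff_subset finite_subset)
  finally show ?thesis .
qed

text \<open>Dividing by \<open>q ^ rk M A\<close> makes each summand independent of
  \<open>A\<close>, so the set carrying the rank can be moved outside.\<close>

lemma characteristic_poly_restriction:
  assumes "A \<subseteq> ground M" "q \<noteq> 0"
  shows "poly (characteristic_poly (restriction M A)) q / q ^ rk M A =
    (\<Sum>B\<in>Pow A. (-1) ^ card B / q ^ rk M B)"
  using assms
  by (auto simp: poly_characteristic_poly restriction_def sum_divide_distrib power_diff rk_mono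
      intro!: sum.cong)

text \<open>The rank of \<open>A\<close> cancels in the exponent, so the rank factor depends only on
  the union of \<open>A\<close> and \<open>B\<close>, by which the pairs are regrouped
  later.\<close>

lemma characteristic_poly_contraction:
  assumes "A \<subseteq> ground M" "q \<noteq> 0"
  shows "poly (characteristic_poly (contraction M A)) q =
    (\<Sum>B\<in>Pow (ground M - A). (-1) ^ card B * (q ^ rk M (ground M) / q ^ rk M (A \<union> B)))"
proof -
  have "rk M (A \<union> (ground M - A)) - rk M A - (rk M (A \<union> B) - rk M A)
      = rk M (ground M) - rk M (A \<union> B)" "rk M (A \<union> B) \<le> rk M (ground M)"
    if "B \<subseteq> ground M - A" for B
  proof -
    have "A \<union> (ground M - A) = ground M" "A \<union> B \<subseteq> ground M"
      using that assms by auto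
    then show "rk M (A \<union> (ground M - A)) - rk M A - (rk M (A \<union> B) - rk M A)
        = rk M (ground M) - rk M (A \<union> B)" "rk M (A \<union> B) \<le> rk M (ground M)"
      using rk_mono[of A "A \<union> B"] rk_mono[of "A \<union> B" "ground M"] by auto
  qed
  then show ?thesis
    using assms by (auto simp: poly_characteristic_poly contraction_def power_diff intro!: sum.cong)
qed

text \<open>For fixed \<open>B\<close>, the sum over \<open>C\<close> is a binomial expansion of
  \<open>(zeta q 1 - 1) ^ card (ground M - B)\<close>, a power of
  \<open>- zeta q (-1)\<close>.\<close>

lemma dual_sum_restrictions:
  assumes q: "q \<noteq> 0" "q \<noteq> 1"
  shows "poly (characteristic_poly (dual M)) q * zeta q (-1) ^ card (ground M) =
    (\<Sum>A\<in>Pow (ground M). (-1) ^ (card (ground M) - card A) *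
      (poly (characteristic_poly (restriction M A)) q / q ^ rk M A) * zeta q 1 ^ card A)"
proof -
  let ?E = "ground M" and ?n = "card (ground M)" and ?z = "zeta q 1" and ?w = "zeta q (-1)"
  have w: "?z + - 1 = - ?w"
    using zeta_add_minus_1[OF q] by (simp add: algebra_simps eq_neg_iff_add_eq_0)
  have "(\<Sum>A\<in>Pow ?E. (-1) ^ (?n - card A) *
        (poly (characteristic_poly (restriction M A)) q / q ^ rk M A) * ?z ^ card A)
      = (\<Sum>A\<in>Pow ?E. \<Sum>B\<in>Pow A. (-1) ^ (?n - card A) * ((-1) ^ card B / q ^ rk M B) * ?z ^ card A)"
    using q by (simp add: characteristic_poly_restriction sum_distrib_left sum_distrib_right)
  also have "\<dots> = (\<Sum>B\<in>Pow ?E. \<Sum>C\<in>Pow (?E - B).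
      (-1) ^ (?n - card (B \<union> C)) * ((-1) ^ card B / q ^ rk M B) * ?z ^ card (B \<union> C))"
    using finite_ground by (rule sum_nested_subsets)
  also have "\<dots> = (\<Sum>B\<in>Pow ?E. (-1) ^ (?n - card B) * (q ^ card B / q ^ rk M B) * ?w ^ ?n)"
  proof (rule sum.cong)
    fix B assume "B \<in> Pow ?E"
    then have B: "B \<subseteq> ?E" and finB: "finite B"
      using finite_ground finite_subset by auto
    have cardD: "card (?E - B) = ?n - card B"
      using B finB by (simp add: card_Diff_subset)
    have cardU: "card (B \<union> C) = card B + card C" if "C \<subseteq> ?E - B" for C
      using that finB finite_ground by (intro card_Un_disjoint) (auto intro: finite_subset)
    have "(\<Sum>C\<in>Pow (?E - B). (-1) ^ (?n - card (B \<union> C)) * ((-1) ^ card B / q ^ rk M B) *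
          ?z ^ card (B \<union> C))
        = (-1) ^ card B / q ^ rk M B * ?z ^ card B *
          (\<Sum>C\<in>Pow (?E - B). ?z ^ card C * (-1) ^ (card (?E - B) - card C))"
      unfolding sum_distrib_left
      by (intro sum.cong) (auto simp: cardU cardD power_add mult_ac)
    also have "\<dots> = (-1) ^ card B / q ^ rk M B * ?z ^ card B * (- ?w) ^ (?n - card B)"
      using finite_ground by (subst binomial_subsets) (simp_all only: w cardD finite_Diff)
    \<comment> \<open>Writing \<open>?z ^ card B\<close> as \<open>(- (q * ?w)) ^ card B\<close>
      supplies \<open>q ^ card B\<close>, and its sign cancels \<open>(-1) ^ card B\<close>.\<close>
    also have "\<dots> = (-1) ^ (?n - card B) * (q ^ card B / q ^ rk M B) *
        (?w ^ card B * ?w ^ (?n - card B))"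
      unfolding zeta_1_eq[OF q] power_minus[of ?w] power_minus[of "q * ?w"] power_mult_distrib
      by simp
    also have "?w ^ card B * ?w ^ (?n - card B) = ?w ^ ?n"
      using card_le_ground[OF B] by (simp flip: power_add)
    finally show "(\<Sum>C\<in>Pow (?E - B). (-1) ^ (?n - card (B \<union> C)) *
        ((-1) ^ card B / q ^ rk M B) * ?z ^ card (B \<union> C))
        = (-1) ^ (?n - card B) * (q ^ card B / q ^ rk M B) * ?w ^ ?n" .
  qed simp
  also have "\<dots> = poly (characteristic_poly (dual M)) q * ?w ^ ?n"
    using q by (simp add: characteristic_poly_dual sum_distrib_right)
  finally show ?thesis by simp
qed

text \<open>With the union \<open>C\<close> fixed, the sum over \<open>A\<close> inside
  \<open>C\<close> collapses to \<open>(1 - zeta q (-1)) ^ card C\<close>, that is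
  \<open>zeta q 1 ^ card C\<close>.\<close>

lemma dual_sum_contractions:
  assumes q: "q \<noteq> 0" "q \<noteq> 1"
  shows "poly (characteristic_poly (dual M)) q / q ^ rk (dual M) (ground M) *
      zeta q 1 ^ card (ground M) =
    (\<Sum>A\<in>Pow (ground M). zeta q (-1) ^ (card (ground M) - card A) *
      poly (characteristic_poly (contraction M A)) q)"
proof -
  let ?E = "ground M" and ?n = "card (ground M)" and ?z = "zeta q 1" and ?w = "zeta q (-1)"
  let ?r = "rk M (ground M)"
  \<comment> \<open>Here \<open>C\<close> is the union of \<open>A\<close> with the set
    \<open>B\<close> indexing the contraction's sum, and \<open>card C - card A\<close> is
    \<open>card B\<close>.\<close>
  define g :: "'a set \<Rightarrow> 'a set \<Rightarrow> complex" where
    "g C A = ?w ^ (?n - card A) * ((-1) ^ (card C - card A) * (q ^ ?r / q ^ rk M C))"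
    for C A
  have z: "1 + - ?w = ?z"
    using zeta_add_minus_1[OF q] by (simp add: algebra_simps)
  have w: "?w = - (?z / q)"
    using q by (simp add: zeta_1_eq)
  have "(\<Sum>A\<in>Pow ?E. ?w ^ (?n - card A) * poly (characteristic_poly (contraction M A)) q)
      = (\<Sum>A\<in>Pow ?E. \<Sum>B\<in>Pow (?E - A). g (A \<union> B) A)"
  proof (rule sum.cong)
    fix A assume "A \<in> Pow ?E"
    then have A: "A \<subseteq> ?E" and finA: "finite A"
      using finite_ground finite_subset by auto
    have "card (A \<union> B) = card A + card B" if "B \<subseteq> ?E - A" for B
      using that finA finite_ground by (intro card_Un_disjoint) (auto intro: finite_subset)
    then show "?w ^ (?n - card A) * poly (characteristic_poly (contraction M A)) q
        = (\<Sum>B\<in>Pow (?E - A). g (A \<union> B) A)"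
      using A q by (auto simp: characteristic_poly_contraction sum_distrib_left g_def intro!: sum.cong)
  qed simp
  also have "\<dots> = (\<Sum>C\<in>Pow ?E. \<Sum>A\<in>Pow C. g C A)"
    using finite_ground by (rule sum_nested_subsets[symmetric])
  also have "\<dots> = (\<Sum>C\<in>Pow ?E. (-1) ^ (?n - card C) * (q ^ card C / q ^ rk M C) *
      (q ^ ?r / q ^ ?n * ?z ^ ?n))"
  proof (rule sum.cong)
    fix C assume "C \<in> Pow ?E"
    then have C: "C \<subseteq> ?E" and finC: "finite C"
      using finite_ground finite_subset by auto
    have split: "y ^ ?n = y ^ card C * y ^ (?n - card C)" for y :: complex
      using card_le_ground[OF C] by (simp flip: power_add)
    have "(\<Sum>A\<in>Pow C. g C A) = q ^ ?r / q ^ rk M C * ?w ^ (?n - card C) *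
        (\<Sum>A\<in>Pow C. 1 ^ card A * (- ?w) ^ (card C - card A))"
      unfolding sum_distrib_left
    proof (rule sum.cong)
      fix A assume "A \<in> Pow C"
      then have "card A \<le> card C"
        using finC by (simp add: card_mono)
      \<comment> \<open>The second part of the exponent lets the sign be absorbed into a power of
        \<open>- ?w\<close>.\<close>
      then have "?n - card A = (?n - card C) + (card C - card A)"
        using card_le_ground[OF C] by simp
      then show "g C A = q ^ ?r / q ^ rk M C * ?w ^ (?n - card C) *
          (1 ^ card A * (- ?w) ^ (card C - card A))"
        by (simp add: g_def power_add power_minus[of ?w] mult_ac)
    qed simp
    also have "\<dots> = q ^ ?r / q ^ rk M C * ?w ^ (?n - card C) * ?z ^ card C"
      using finC by (subst binomial_subsets) (simp_all only: z)
    \<comment> \<open>Replacing \<open>?w\<close> by \<open>- (?z / q)\<close> completes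
      \<open>?z ^ card C\<close> to \<open>?z ^ ?n\<close> and yields
      \<open>q ^ card C / q ^ ?n\<close>.\<close>
    also have "\<dots> = (-1) ^ (?n - card C) * (q ^ card C / q ^ rk M C) *
        (q ^ ?r / q ^ ?n * ?z ^ ?n)"
      unfolding w split power_minus[of "?z / q"] using q by (simp add: power_divide)
    finally show "(\<Sum>A\<in>Pow C. g C A) = (-1) ^ (?n - card C) * (q ^ card C / q ^ rk M C) *
        (q ^ ?r / q ^ ?n * ?z ^ ?n)" .
  qed simp
  also have "\<dots> = poly (characteristic_poly (dual M)) q * (q ^ ?r / q ^ ?n * ?z ^ ?n)"
    by (simp only: characteristic_poly_dual[OF q(1)] sum_distrib_right)
  also have "q ^ ?r / q ^ ?n * ?z ^ ?n = ?z ^ ?n / q ^ rk (dual M) ?E"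
    using q rk_le_card[of ?E] by (simp add: rk_dual_ground power_diff)
  finally show ?thesis by simp
qed

end

theorem theorem1:
  fixes M :: "'a ranked_set" and q :: complex
  assumes "matroid M" and "q \<noteq> 0" and "q \<noteq> 1"
  shows "poly (characteristic_poly (dual M)) q * zeta q (-1) ^ card (ground M) =
      (\<Sum>A \<in> Pow (ground M). (-1) ^ (card (ground M) - card A) *
         (poly (characteristic_poly (restriction M A)) q / q ^ rk M A) * zeta q 1 ^ card A)
    \<and> poly (characteristic_poly (dual M)) q / q ^ rk (dual M) (ground M) *
        zeta q 1 ^ card (ground M) =
      (\<Sum>A \<in> Pow (ground M). zeta q (-1) ^ (card (ground M) - card A) *
         poly (characteristic_poly (contraction M A)) q)"
  using matroid.dual_sum_restrictions[OF assms] matroid.dual_sum_contractions[OF assms] ..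

end
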